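(* Let $p>2$ be a prime and let $n$ be a positive integer. Let $a$ and $b$ be even integers with $0\le a<b\le p-1$. Let $s,t$ be positive integers with $n\le s\le t$, and let $i$ be an arbitrary non-negative integer. Then, in $\mathbb{Z}[q]$, $$\sum_{r=0}^{2^n-1}(-1)^r\genfrac{[}{]}{0pt}{}{k_r^{(s)}/2}{i}_q\genfrac{[}{]}{0pt}{}{\alpha^{(t)}(a,b)-i}{k_r^{(s)}/2}_q\equiv 0 \pmod{[p^n]_q},$$ where $[p^n]_q=\frac{1-q^{p^n}}{1-q}$ and $k_r^{(s)}$, $\alpha^{(t)}(a,b)$ are the integers defined in the context.
   Context: For a non-negative integer $r$ with binary expansion $r=\sum_{j\ge 0} r_j2^j$, $r_j\in\{0,1\}$, set $k_r:=\sum_{j=0}^{\infty}\big((b-a)r_j+a\big)p^j\in\mathbb{Z}_p$, and let $k_r^{(s)}:=\sum_{j=0}^{s-1}\big((b-a)r_j+a\big)p^j\in\mathbb{Z}$ be its truncation to the first $s$ $p$-adic digits. Since $a,b$ are even, $k_r^{(s)}/2$ is a non-negative integer. Set $\alpha(a,b):=\sum_{j=0}^{\infty}\frac{a+b}{2}p^j=\frac{a+b}{2(1-p)}\in\mathbb{Z}_p$ and $\alpha^{(t)}(a,b):=\sum_{j=0}^{t-1}\frac{a+b}{2}p^j\in\mathbb{Z}$. For integers $0\le k\le N$ the $q$-binomial coefficient is $\genfrac{[}{]}{0pt}{}{N}{k}_q=\frac{[N]_q!}{[k]_q!\,[N-k]_q!}\in\mathbb{Z}[q]$, where $[N]_q=\frac{1-q^N}{1-q}$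 and $[N]_q!=\prod_{j=1}^N[j]_q$, $[0]_q!=1$. More generally, for any integer $N$ and $k\ge0$, $\genfrac{[}{]}{0pt}{}{N}{k}_q=\prod_{j=0}^{k-1}\frac{1-q^{N-j}}{1-q^{j+1}}$; in particular it is $0$ if $0\le N<k$. (If $\alpha^{(t)}(a,b)-i<0$, then $i>k_r^{(s)}/2$, so the first factor in every summand is $0$.) *)

theory Defs
  imports "HOL-Computational_Algebra.Computational_Algebra"
begin

text \<open>
  The \<open>q\<close>-analogues live in the fraction field of \<open>\<int>[q]\<close>, where the defining quotients make sense
  for every integer upper index; \<open>Zq\<close> is the subring \<open>\<int>[q]\<close>.
\<close>

definition qvar :: "int poly fract" where
  "qvar = to_fract [:0, 1:]"

definition Zq :: "int poly fract set" where
  "Zq = range to_fract"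

definition qint :: "nat \<Rightarrow> int poly fract" where
  "qint N = (1 - qvar ^ N) / (1 - qvar)"

definition qfact :: "nat \<Rightarrow> int poly fract" where
  "qfact N = (\<Prod>j=1..N. qint j)"

definition qbinomial :: "int \<Rightarrow> nat \<Rightarrow> int poly fract" where
  "qbinomial N k = (\<Prod>j<k. (1 - qvar powi (N - int j)) / (1 - qvar ^ (j + 1)))"

text \<open>Congruence in the ring \<open>\<int>[q]\<close>; the quotient must itself lie in \<open>\<int>[q]\<close>.\<close>

definition cong_Zq :: "int poly fract \<Rightarrow> int poly fract \<Rightarrow> int poly fract \<Rightarrow> bool" where
  "cong_Zq x y m \<longleftrightarrow> x \<in> Zq \<and> y \<in> Zq \<and> m \<in> Zq \<and> (\<exists>c\<in>Zq. x - y = m * c)"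

definition bin_digit :: "nat \<Rightarrow> nat \<Rightarrow> nat" where
  "bin_digit r j = (r div 2 ^ j) mod 2"

definition k_trunc :: "nat \<Rightarrow> int \<Rightarrow> int \<Rightarrow> nat \<Rightarrow> nat \<Rightarrow> int" where
  "k_trunc p a b r s = (\<Sum>j<s. ((b - a) * int (bin_digit r j) + a) * int p ^ j)"

text \<open>The integer division is exact in the intended use, where \<open>a\<close> and \<open>b\<close> are even.\<close>

definition alpha_trunc :: "nat \<Rightarrow> int \<Rightarrow> int \<Rightarrow> nat \<Rightarrow> int" where
  "alpha_trunc p a b t = (\<Sum>j<t. ((a + b) div 2) * int p ^ j)"


subsection \<open>Agreement with the factorial formula and integrality\<close>

lemma qvar_power: "qvar ^ n = to_fract (monom 1 n)"
  by (induction n) (auto simp: qvar_def monom_Suc simp flip: to_fract_mult to_fract_1)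

lemma qvar_power_neq_1: "n > 0 \<Longrightarrow> qvar ^ n \<noteq> 1"
  by (metis degree_1 degree_monom_eq less_not_refl one_neq_zero qvar_power to_fract_1 to_fract_eq_iff)

lemma qvar_neq_0: "qvar \<noteq> 0"
  by (simp add: qvar_def)

lemma qint_nonzero: "n > 0 \<Longrightarrow> qint n \<noteq> 0"
  using qvar_power_neq_1[of n] qvar_power_neq_1[of 1] by (auto simp: qint_def)

lemma qint_eq_sum: "qint N = (\<Sum>j<N. qvar ^ j)"
  using qvar_power_neq_1[of 1] by (simp add: qint_def sum_gp_strict)

lemma qfact_nonzero: "qfact n \<noteq> 0"
  by (auto simp: qfact_def qint_nonzero)

lemma qfact_Suc: "qfact (Suc n) = qfact n * qint (Suc n)"
  by (simp add: qfact_def)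

lemma qbinomial_eq_0: "N < k \<Longrightarrow> qbinomial (int N) k = 0"
  unfolding qbinomial_def by (rule prod_zero[OF _ bexI[of _ N]]) auto

lemma qbinomial_0: "qbinomial N 0 = 1"
  by (simp add: qbinomial_def)

lemma qbinomial_Suc:
  "qbinomial N (Suc k) = qbinomial N k * ((1 - qvar powi (N - int k)) / (1 - qvar ^ (k + 1)))"
  by (simp add: qbinomial_def)

lemma qbinomial_eq_qfact:
  assumes "k \<le> N"
  shows "qbinomial (int N) k = qfact N / (qfact k * qfact (N - k))"
  using assms
proof (induction k)
  case 0
  then show ?case using qfact_nonzero by (simp add: qbinomial_0) (simp add: qfact_def)
next
  case (Suc k)
  have q: "qfact (N - k) = qfact (N - Suc k) * qint (N - k)"
  proof -
    have "N - k = Suc (N - Suc k)" using Suc.prems by simp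
    then show ?thesis by (metis qfact_Suc)
  qed
  have "qvar powi (int N - int k) = qvar ^ (N - k)"
    using Suc.prems by (metis Suc_leD of_nat_diff power_int_of_nat)
  then have "(1 - qvar powi (int N - int k)) / (1 - qvar ^ (k + 1)) = qint (N - k) / qint (Suc k)"
    using qvar_power_neq_1[of 1] by (simp add: qint_def)
  then have "qbinomial (int N) (Suc k) = qfact N / (qfact k * qfact (N - k)) * (qint (N - k) / qint (Suc k))"
    using Suc by (simp add: qbinomial_Suc)
  also have "\<dots> = qfact N / (qfact (Suc k) * qfact (N - Suc k))"
    using Suc.prems qint_nonzero[of "N - k"] by (simp add: q qfact_Suc)
  finally show ?case .
qed

lemma Zq_closed:
  "0 \<in> Zq" "1 \<in> Zq" "qvar ^ n \<in> Zq"
  "x \<in> Zq \<Longrightarrow> y \<in> Zq \<Longrightarrow> x + y \<in> Zq" "x \<in> Zq \<Longrightarrow> y \<in> Zq \<Longrightarrow> x * y \<in> Zq"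
  unfolding Zq_def by (auto simp: qvar_power simp flip: to_fract_0 to_fract_1 to_fract_add to_fract_mult)

lemma qint_in_Zq: "qint n \<in> Zq"
  by (induction n) (auto simp: qint_eq_sum Zq_closed)

lemma qbinomial_Pascal:
  "qbinomial (N + 1) (Suc k) = qbinomial N k + qvar ^ (Suc k) * qbinomial N (Suc k)"
proof -
  have shift: "qbinomial (N + 1) (Suc k) = qbinomial N k * ((1 - qvar powi (N + 1)) / (1 - qvar ^ (k + 1)))"
  proof (induction k)
    case 0
    then show ?case by (simp add: qbinomial_def)
  next
    case (Suc k)
    show ?case
      unfolding qbinomial_Suc[of "N + 1" "Suc k"] Suc.IH unfolding qbinomial_Suc[of N k]
      by (simp add: ac_simps)
  qed
  have p: "qvar powi (N + 1) = qvar ^ (Suc k) * qvar powi (N - int k)"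
    using qvar_neq_0 by (subst power_int_of_nat[symmetric], subst power_int_add[symmetric]) (auto simp: add.commute)
  have "1 - qvar ^ (k + 1) \<noteq> 0" using qvar_power_neq_1[of "k + 1"] by simp
  then show ?thesis
    unfolding shift p qbinomial_Suc[of N k] by (simp add: field_simps)
qed

lemma qbinomial_in_Zq: "qbinomial (int N) k \<in> Zq"
proof (induction N arbitrary: k)
  case 0
  then show ?case
    using qbinomial_eq_0[of 0 k] by (cases k) (auto simp: qbinomial_0 Zq_closed)
next
  case (Suc N)
  show ?case
  proof (cases k)
    case 0
    then show ?thesis by (simp add: qbinomial_0 Zq_closed)
  next
    case (Suc k')
    then show ?thesis
      using qbinomial_Pascal[of "int N" k'] Suc.IH
      by (simp add: add.commute Zq_closed del: power_Suc)
  qed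
qed

end

theory Submission
  imports Defs
begin

text \<open>
  The polynomial \<open>[p^n]\<close> is monic and its complex roots are the \<open>p^n\<close>-th roots of unity \<open>z \<noteq> 1\<close>, all
  simple, so it suffices that the sum vanishes at each of them. Such a \<open>z\<close> has order \<open>p^m\<close> with
  \<open>1 \<le> m \<le> n\<close>. Write \<open>r = 2^m u + v\<close> with \<open>v < 2^m\<close>. By the \<open>q\<close>-Lucas theorem the summand splits into a factor
  depending on \<open>u\<close> only and the summand for \<open>v\<close> belonging to \<open>s = t = m\<close>. The latter summand is up to
  its sign a \<open>q\<close>-trinomial coefficient, invariant under \<open>k \<mapsto> \<alpha> - k\<close>; this corresponds to
  complementing the binary digits of \<open>v\<close>, which flips the sign.
\<close>

section \<open>Gaussian binomial coefficients in a commutative ring\<close>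

text \<open>Pascal's recursion replaces the quotient formula, which can read 0/0 at a root of
  unity.\<close>

fun gauss_binomial :: "'a::comm_ring_1 \<Rightarrow> nat \<Rightarrow> nat \<Rightarrow> 'a" where
  "gauss_binomial q N 0 = 1"
| "gauss_binomial q 0 (Suc k) = 0"
| "gauss_binomial q (Suc N) (Suc k) = gauss_binomial q N k + q ^ Suc k * gauss_binomial q N (Suc k)"

lemma gauss_binomial_eq_0: "N < k \<Longrightarrow> gauss_binomial q N k = 0"
  by (induction q N k rule: gauss_binomial.induct) auto

lemma gauss_binomial_self: "gauss_binomial q N N = 1"
  by (induction N) (simp_all add: gauss_binomial_eq_0)

text \<open>With denominators cleared this makes sense in any commutative ring; Pascal's rule and
  subtraction suffice, without cancellation.\<close>

lemma gauss_binomial_absorb: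
  "(1 - q ^ Suc k) * gauss_binomial q (Suc N) (Suc k) = (1 - q ^ Suc N) * gauss_binomial q N k"
proof (induction N arbitrary: k)
  case 0
  show ?case by (cases k) auto
next
  case (Suc M)
  show ?case
  proof (cases k)
    case 0
    have "(1 - q) * gauss_binomial q (Suc (Suc M)) (Suc 0)
        = (1 - q) + q * ((1 - q ^ Suc 0) * gauss_binomial q (Suc M) (Suc 0))"
      by (subst gauss_binomial.simps(3)) (simp only: gauss_binomial.simps(1), simp add: algebra_simps)
    also have "\<dots> = 1 - q ^ Suc (Suc M)"
      by (subst Suc.IH) (simp add: algebra_simps)
    finally show ?thesis using 0 by simp
  next
    case k: (Suc j)
    define x where "x = gauss_binomial q M k"
    define y where "y = gauss_binomial q M j"
    define w where "w = gauss_binomial q (Suc M) k"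
    have w: "w = y + q ^ k * x" unfolding w_def x_def y_def k by simp
    have w2: "(1 - q ^ k) * w = (1 - q ^ Suc M) * y" using Suc.IH[of j] by (simp add: w_def y_def k)
    have "(1 - q ^ Suc M) * (q ^ k * x) = (1 - q ^ Suc M) * w - (1 - q ^ Suc M) * y"
      unfolding w by (simp add: algebra_simps)
    also have "\<dots> = (1 - q ^ Suc M) * w - (1 - q ^ k) * w" by (simp only: w2)
    finally have x: "(1 - q ^ Suc M) * (q ^ k * x) = (q ^ k - q ^ Suc M) * w"
      by (simp add: algebra_simps)
    have "(1 - q ^ Suc k) * gauss_binomial q (Suc (Suc M)) (Suc k)
        = (1 - q ^ Suc k) * w + q ^ Suc k * ((1 - q ^ Suc k) * gauss_binomial q (Suc M) (Suc k))"
      by (subst gauss_binomial.simps(3)) (simp only: w_def, simp only: algebra_simps)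
    also have "\<dots> = (1 - q ^ Suc k) * w + q * ((1 - q ^ Suc M) * (q ^ k * x))"
      by (subst Suc.IH) (simp add: x_def algebra_simps)
    also have "\<dots> = (1 - q ^ Suc (Suc M)) * w"
      by (subst x) (simp add: algebra_simps)
    finally show ?thesis by (simp only: w_def)
  qed
qed

text \<open>The factorial formula without division, by iterated absorption; the powers of
  \<open>1 - q\<close> on the two sides agree.\<close>

lemma gauss_binomial_mult_prod:
  "gauss_binomial q (k + l) k * ((\<Prod>j=1..k. 1 - q ^ j) * (\<Prod>j=1..l. 1 - q ^ j))
     = (\<Prod>j=1..k+l. 1 - q ^ j)"
proof (induction k)
  case 0
  show ?case by simp
next
  case (Suc k)
  have "gauss_binomial q (Suc (k + l)) (Suc k)
            * ((\<Prod>j=1..Suc k. 1 - q ^ j) * (\<Prod>j=1..l. 1 - q ^ j))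
      = ((1 - q ^ Suc k) * gauss_binomial q (Suc (k + l)) (Suc k))
            * ((\<Prod>j=1..k. 1 - q ^ j) * (\<Prod>j=1..l. 1 - q ^ j))"
    by (simp add: mult_ac del: gauss_binomial.simps power_Suc)
  also have "\<dots> = (1 - q ^ Suc (k + l)) * (gauss_binomial q (k + l) k
            * ((\<Prod>j=1..k. 1 - q ^ j) * (\<Prod>j=1..l. 1 - q ^ j)))"
    by (subst gauss_binomial_absorb) (simp only: mult_ac)
  also have "\<dots> = (\<Prod>j=1..Suc (k+l). 1 - q ^ j)"
    by (subst Suc.IH) (simp add: mult_ac)
  finally show ?case by simp
qed

text \<open>The recursion uses ring operations only. This transfers coefficients from integer
  polynomials both to the fraction field and to complex values.\<close>

lemma gauss_binomial_hom:
  fixes h :: "'a::comm_ring_1 \<Rightarrow> 'b::comm_ring_1"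
  assumes "h 0 = 0" "h 1 = 1" "\<And>x y. h (x + y) = h x + h y" "\<And>x y. h (x * y) = h x * h y"
  shows "h (gauss_binomial q N k) = gauss_binomial (h q) N k"
proof -
  have "h (q ^ j) = h q ^ j" for j by (induction j) (auto simp: assms)
  then show ?thesis
    by (induction q N k rule: gauss_binomial.induct) (simp_all add: assms del: power_Suc)
qed

lemma qbinomial_eq_gauss: "qbinomial (int N) k = gauss_binomial qvar N k"
proof (induction N arbitrary: k)
  case 0
  show ?case using qbinomial_eq_0[of 0 k] by (cases k) (auto simp: qbinomial_0)
next
  case (Suc N)
  show ?case
    using qbinomial_Pascal[of "int N"] Suc.IH
    by (cases k) (auto simp: qbinomial_0 add.commute simp del: power_Suc)
qed

section \<open>The Lucas theorem at a root of unity\<close>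

locale primitive_root =
  fixes q :: "'a::idom" and P :: nat
  assumes pos: "P > 0" and root: "q ^ P = 1" and primitive: "\<And>j. 0 < j \<Longrightarrow> j < P \<Longrightarrow> q ^ j \<noteq> 1"
begin

text \<open>In the absorption identity the right side contains \<open>1 - q ^ P = 0\<close>, while
  \<open>1 - q ^ k\<close> on the left is nonzero in a domain.\<close>

lemma gauss_binomial_order: "0 < k \<Longrightarrow> k < P \<Longrightarrow> gauss_binomial q P k = 0"
  using gauss_binomial_absorb[of q "k - 1" "P - 1"] pos root primitive[of k] by simp

text \<open>Of the \<open>q\<close>-Vandermonde sum only the terms for 0 and \<open>P\<close>
  survive. The proof is an induction on \<open>N\<close> by Pascal's rule.\<close>

lemma gauss_binomial_add_order:
  "gauss_binomial q (P + N) k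
     = gauss_binomial q N k + (if P \<le> k then gauss_binomial q N (k - P) else 0)"
proof (induction N arbitrary: k)
  case 0
  consider "k = 0" | "0 < k" "k < P" | "k = P" | "P < k" by linarith
  then show ?case
    using pos by cases (auto simp: gauss_binomial_order gauss_binomial_self gauss_binomial_eq_0)
next
  case (Suc N)
  show ?case
  proof (cases k)
    case 0
    then show ?thesis using pos by simp
  next
    case k: (Suc j)
    have step: "gauss_binomial q (P + Suc N) k
        = gauss_binomial q N j + (if P \<le> j then gauss_binomial q N (j - P) else 0)
          + q ^ k * (gauss_binomial q N k + (if P \<le> k then gauss_binomial q N (k - P) else 0))"
      unfolding k using Suc.IH[of j] Suc.IH[of "Suc j"] by (simp del: power_Suc)
    have pascal: "gauss_binomial q (Suc N) k = gauss_binomial q N j + q ^ k * gauss_binomial q N k"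
      unfolding k by simp
    \<comment> \<open>At \<open>k = P\<close> the shifted term first appears, with coefficient
      \<open>q ^ P = 1\<close>. Beyond it \<open>q ^ k = q ^ (k - P)\<close>, so the shifted terms
      obey Pascal's rule too.\<close>
    consider "k < P" | "k = P" | "P \<le> j" using k by linarith
    then show ?thesis
    proof cases
      case 1
      then show ?thesis unfolding step pascal using k by simp
    next
      case 2
      then have "q ^ k = 1" "\<not> P \<le> j" using k root by auto
      then show ?thesis unfolding step pascal using 2 by simp
    next
      case 3
      then obtain l where "j = P + l" using le_Suc_ex by blast
      then have "k - P = Suc l" "j - P = l" "P \<le> k" "q ^ k = q ^ Suc l"
        by (simp_all add: k power_add root)
      then show ?thesis unfolding step pascal using 3 by (simp add: algebra_simps)
    qed
  qed
qed

text \<open>Splitting off one block of length \<open>P\<close> is one step of the ordinary Pascal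
  recursion in \<open>N\<close> and \<open>K\<close>; hence the integer binomial factor.\<close>

theorem gauss_binomial_Lucas:
  assumes "n < P" "k < P"
  shows "gauss_binomial q (n + P * N) (k + P * K) = of_nat (N choose K) * gauss_binomial q n k"
proof (induction N arbitrary: K)
  case 0
  show ?case
  proof (cases K)
    case (Suc K')
    then have "n < k + P * K" using assms by simp
    then show ?thesis using Suc by (simp add: gauss_binomial_eq_0)
  qed simp
next
  case (Suc N)
  have e: "n + P * Suc N = P + (n + P * N)" by simp
  show ?case
  proof (cases K)
    case 0
    then show ?thesis unfolding e gauss_binomial_add_order using Suc.IH[of 0] assms by simp
  next
    case K: (Suc K')
    then have "k + P * K - P = k + P * K'" "P \<le> k + P * K" by simp_all
    then have "gauss_binomial q (n + P * Suc N) (k + P * K)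
        = gauss_binomial q (n + P * N) (k + P * K) + gauss_binomial q (n + P * N) (k + P * K')"
      unfolding e gauss_binomial_add_order by simp
    then show ?thesis unfolding Suc.IH by (simp add: K algebra_simps)
  qed
qed

lemma prod_one_minus_nonzero:
  assumes "N < P"
  shows "(\<Prod>j=1..N. 1 - q ^ j) \<noteq> 0"
proof -
  have "q ^ j \<noteq> 1" if "j \<in> {1..N}" for j using primitive[of j] that assms by simp
  then show ?thesis by simp
qed

text \<open>When all lower indices are in range, both sides are the trinomial with numerator
  \<open>\<alpha> - i\<close> and parts \<open>i\<close>, \<open>k - i\<close>,
  \<open>\<alpha> - i - k\<close>, the last two being swapped. Since \<open>\<alpha> < P\<close>,
  the denominators are nonzero and cancel. Otherwise both sides vanish.\<close>

lemma gauss_trinomial_symmetric: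
  assumes "\<alpha> < P" "k \<le> \<alpha>"
  shows "gauss_binomial q (\<alpha> - k) i * gauss_binomial q (\<alpha> - i) (\<alpha> - k)
       = gauss_binomial q k i * gauss_binomial q (\<alpha> - i) k"
proof (cases "i \<le> k \<and> i \<le> \<alpha> - k")
  case True
  let ?F = "\<lambda>N. \<Prod>j=1..N. 1 - q ^ j"
  have eq: "gauss_binomial q k i * gauss_binomial q (\<alpha> - i) k * (?F i * (?F (k - i) * ?F (\<alpha> - i - k)))
      = ?F (\<alpha> - i)" if "i \<le> k" "i \<le> \<alpha> - k" "k \<le> \<alpha>" for k
  proof -
    have 1: "gauss_binomial q k i * (?F i * ?F (k - i)) = ?F k"
      using gauss_binomial_mult_prod[of q i "k - i"] that by simp
    have 2: "gauss_binomial q (\<alpha> - i) k * (?F k * ?F (\<alpha> - i - k)) = ?F (\<alpha> - i)"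
      using gauss_binomial_mult_prod[of q k "\<alpha> - i - k"] that by simp
    show ?thesis unfolding 2[symmetric] 1[symmetric] by (simp only: mult_ac)
  qed
  have "\<alpha> - i - (\<alpha> - k) = k - i" "\<alpha> - k - i = \<alpha> - i - k" using True assms by auto
  then have "gauss_binomial q (\<alpha> - k) i * gauss_binomial q (\<alpha> - i) (\<alpha> - k)
          * (?F i * (?F (k - i) * ?F (\<alpha> - i - k)))
      = gauss_binomial q k i * gauss_binomial q (\<alpha> - i) k * (?F i * (?F (k - i) * ?F (\<alpha> - i - k)))"
    using eq[of k] eq[of "\<alpha> - k"] True assms by (simp add: mult_ac)
  moreover have "?F i * (?F (k - i) * ?F (\<alpha> - i - k)) \<noteq> 0"
    by (intro no_zero_divisors prod_one_minus_nonzero) (use assms True in auto)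
  ultimately show ?thesis by simp
next
  case False
  have "gauss_binomial q k i * gauss_binomial q (\<alpha> - i) k = 0"
    if "\<not> (i \<le> k \<and> i \<le> \<alpha> - k)" "k \<le> \<alpha>" for k
    using that gauss_binomial_eq_0[of k i q] gauss_binomial_eq_0[of "\<alpha> - i" k q] by fastforce
  from this[of k] this[of "\<alpha> - k"] show ?thesis using False assms by force
qed

end

section \<open>Divisibility by $[N]_q$ from vanishing at roots of unity\<close>

abbreviation eval_complex :: "int poly \<Rightarrow> complex \<Rightarrow> complex" where
  "eval_complex f z \<equiv> poly (map_poly of_int f) z"

lemma map_poly_of_int_add:
  "map_poly of_int (f + g) = (map_poly of_int f + map_poly of_int g :: 'a::comm_ring_1 poly)"
  by (rule poly_eqI) (simp add: coeff_map_poly)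

lemma map_poly_of_int_mult:
  "map_poly of_int (f * g) = (map_poly of_int f * map_poly of_int g :: 'a::comm_ring_1 poly)"
  by (rule poly_eqI) (simp add: coeff_map_poly coeff_mult)

lemma eval_complex_sum: "eval_complex (\<Sum>x\<in>A. f x) z = (\<Sum>x\<in>A. eval_complex (f x) z)"
  by (induction A rule: infinite_finite_induct) (simp_all add: map_poly_of_int_add)

lemma eval_complex_minus_one_power: "eval_complex ((-1) ^ r) z = (-1) ^ r"
proof -
  have "eval_complex (-1) z = -1"
    by (simp add: one_pCons map_poly_pCons)
  then show ?thesis by (simp add: minus_one_power_iff)
qed

text \<open>The remainder modulo \<open>[N]\<close> has degree below \<open>N - 1\<close> but
  vanishes at the \<open>N - 1\<close> nontrivial roots of unity, so it is zero.\<close>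

lemma cong_Zq_qintI:
  assumes "N > 0" and zero: "\<And>z. z ^ N = 1 \<Longrightarrow> z \<noteq> 1 \<Longrightarrow> eval_complex f z = 0"
  shows "cong_Zq (to_fract f) 0 (qint N)"
proof -
  define g :: "int poly" where "g = (\<Sum>j<N. monom 1 j)"
  have coeff_g: "coeff g j = (if j < N then 1 else 0)" for j
    by (auto simp: g_def coeff_sum)
  have deg: "degree g = N - 1"
    using assms(1) by (intro antisym degree_le le_degree) (auto simp: coeff_g)
  have "g \<noteq> 0" using coeff_g[of 0] assms(1) by auto
  \<comment> \<open>Pseudo-division scales \<open>f\<close> by a power of the leading coefficient of
    \<open>g\<close>, here 1, so it is true division with integer coefficients.\<close>
  obtain c r where cr: "pseudo_divmod f g = (c, r)" by fastforce
  have f: "f = g * c + r" and r: "r = 0 \<or> degree r < N - 1"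
    using pseudo_divmod[OF \<open>g \<noteq> 0\<close> cr] assms(1) by (auto simp: deg coeff_g)
  have "r = 0"
  proof (rule ccontr)
    assume "r \<noteq> 0"
    define R :: "complex poly" where "R = map_poly of_int r"
    have "R \<noteq> 0" using \<open>r \<noteq> 0\<close> by (simp add: R_def map_poly_eq_0_iff)
    have "poly R z = 0" if z: "z ^ N = 1" "z \<noteq> 1" for z
    proof -
      have "eval_complex g z = (\<Sum>j<N. z ^ j)"
        unfolding g_def eval_complex_sum by (simp add: map_poly_monom poly_monom)
      also have "\<dots> = 0" using z by (simp add: sum_gp_strict)
      finally show ?thesis using zero[OF z]
        by (simp add: R_def f map_poly_of_int_add map_poly_of_int_mult)
    qed
    then have "{z. z ^ N = 1} - {1} \<subseteq> {z. poly R z = 0}" by auto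
    then have "card ({z::complex. z ^ N = 1} - {1}) \<le> card {z. poly R z = 0}"
      using poly_roots_finite[OF \<open>R \<noteq> 0\<close>] by (intro card_mono)
    also have "\<dots> \<le> degree r"
      using card_poly_roots_bound[OF \<open>R \<noteq> 0\<close>] degree_map_poly[of "of_int :: int \<Rightarrow> complex" r] by (simp add: R_def)
    finally show False
      using r \<open>r \<noteq> 0\<close> card_roots_unity_eq[OF assms(1)] finite_roots_unity[of N] assms(1)
      by (simp add: card_Diff_subset)
  qed
  moreover have "to_fract g = qint N"
    by (simp add: g_def qint_eq_sum qvar_power)
  ultimately have "to_fract f = qint N * to_fract c" using f by simp
  moreover have "to_fract f \<in> Zq" "to_fract c \<in> Zq" by (simp_all add: Zq_def)
  ultimately show ?thesis
    unfolding cong_Zq_def using Zq_closed(1) qint_in_Zq by auto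
qed

section \<open>The digit sums\<close>

text \<open>For \<open>A = a/2\<close> and \<open>B = b/2\<close> this is half of the truncation of
  \<open>k_r\<close>, kept as a natural number.\<close>

definition digit_sum :: "nat \<Rightarrow> nat \<Rightarrow> nat \<Rightarrow> nat \<Rightarrow> nat \<Rightarrow> nat" where
  "digit_sum p A B r s = (\<Sum>j<s. (if bin_digit r j = 0 then A else B) * p ^ j)"

lemma bin_digit_0: "bin_digit r 0 = r mod 2"
  by (simp add: bin_digit_def)

lemma bin_digit_Suc: "bin_digit r (Suc j) = bin_digit (r div 2) j"
  by (simp add: bin_digit_def div_mult2_eq)

text \<open>Subtracting from \<open>2 ^ m - 1\<close> never borrows, so it flips every bit; the
  induction peels off the lowest one.\<close>

lemma bin_digit_complement:
  "v < 2 ^ m \<Longrightarrow> j < m \<Longrightarrow> bin_digit (2 ^ m - 1 - v) j = 0 \<longleftrightarrow> bin_digit v j \<noteq> 0"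
proof (induction m arbitrary: v j)
  case (Suc m)
  show ?case
  proof (cases j)
    case 0
    have "(2 ^ Suc m - 1 - v) mod 2 = 0 \<longleftrightarrow> v mod 2 \<noteq> 0"
      using Suc.prems(1) by (simp add: even_iff_mod_2_eq_zero[symmetric] even_diff_nat)
    then show ?thesis by (simp add: 0 bin_digit_0)
  next
    case (Suc i)
    have "(2 ^ Suc m - 1 - v) div 2 = 2 ^ m - 1 - v div 2" using Suc.prems(1) by simp
    then show ?thesis using Suc.IH[of "v div 2" i] Suc.prems Suc by (simp add: bin_digit_Suc)
  qed
qed simp

lemma bin_digit_low: "v < 2 ^ m \<Longrightarrow> j < m \<Longrightarrow> bin_digit (u * 2 ^ m + v) j = bin_digit v j"
proof (induction m arbitrary: v j)
  case (Suc m)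
  have "(u * 2 ^ Suc m + v) div 2 = u * 2 ^ m + v div 2" by simp
  then show ?case using Suc.IH[of "v div 2" "j - 1"] Suc.prems
    by (cases j) (auto simp: bin_digit_Suc bin_digit_0 mod2_eq_if)
qed simp

lemma bin_digit_high: "v < 2 ^ m \<Longrightarrow> bin_digit (u * 2 ^ m + v) (m + j) = bin_digit u j"
  by (simp add: bin_digit_def power_add div_mult2_eq)

text \<open>At each position one of the two numbers contributes \<open>A\<close> and the other
  \<open>B\<close>.\<close>

lemma digit_sum_complement:
  assumes "v < 2 ^ m"
  shows "digit_sum p A B (2 ^ m - 1 - v) m + digit_sum p A B v m = (\<Sum>j<m. (A + B) * p ^ j)"
  unfolding digit_sum_def sum.distrib[symmetric]
  by (intro sum.cong) (auto simp: bin_digit_complement[OF assms, simplified] add_mult_distrib)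

lemma sum_split_low:
  fixes d :: "nat \<Rightarrow> nat"
  assumes "m \<le> s"
  shows "(\<Sum>j<s. d j * p ^ j) = (\<Sum>j<m. d j * p ^ j) + p ^ m * (\<Sum>j<s-m. d (m + j) * p ^ j)"
proof -
  have "(\<Sum>j<m+l. d j * p ^ j) = (\<Sum>j<m. d j * p ^ j) + (\<Sum>j<l. d (m + j) * p ^ (m + j))" for l
    by (induction l) simp_all
  from this[of "s - m"] show ?thesis using assms by (simp add: power_add sum_distrib_left mult_ac)
qed

lemma digit_sum_split:
  assumes "m \<le> s" "v < 2 ^ m"
  shows "digit_sum p A B (u * 2 ^ m + v) s
       = digit_sum p A B v m + p ^ m * digit_sum p A B u (s - m)"
  unfolding digit_sum_def sum_split_low[OF assms(1)]
  by (simp add: bin_digit_low bin_digit_high assms(2))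

lemma digit_sum_le: "s \<le> t \<Longrightarrow> digit_sum p A B r s \<le> (\<Sum>j<t. (A + B) * p ^ j)"
  unfolding digit_sum_def
  by (rule order.trans[OF sum_mono[where g = "\<lambda>j. (A + B) * p ^ j"] sum_mono2]) auto

text \<open>This bounds the low part of \<open>\<alpha>\<close> by the order of the root, as the
  Lucas theorem and the trinomial symmetry require.\<close>

lemma digits_less_power:
  fixes c p :: nat
  assumes "c < p"
  shows "(\<Sum>j<m. c * p ^ j) < p ^ m"
proof (induction m)
  case (Suc m)
  have "(\<Sum>j<Suc m. c * p ^ j) < p ^ m + c * p ^ m" using Suc.IH by simp
  also have "\<dots> = Suc c * p ^ m" by simp
  also have "\<dots> \<le> p ^ Suc m" using assms by (simp del: mult_Suc)
  finally show ?case .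
qed simp

section \<open>The sum at a root of unity of order a power of $p$\<close>

lemma alternating_sum_low_digits:
  fixes q :: "'a::{idom,ring_char_0}"
  assumes "primitive_root q (p ^ m)" "m \<ge> 1" "A + B < p"
  shows "(\<Sum>v<2^m. (-1) ^ v * gauss_binomial q (digit_sum p A B v m) i
            * gauss_binomial q ((\<Sum>j<m. (A + B) * p ^ j) - i) (digit_sum p A B v m)) = 0"
    (is "(\<Sum>v<2^m. ?f v) = 0")
proof -
  interpret primitive_root q "p ^ m" by fact
  let ?\<alpha> = "\<Sum>j<m. (A + B) * p ^ j"
  \<comment> \<open>Complementing bits sends the digit sum \<open>k\<close> to
    \<open>?\<alpha> - k\<close>. The sign flips because \<open>2 ^ m - 1\<close> is odd for
    \<open>m \<ge> 1\<close>. Reindexing then shows that the sum equals its own negative.\<close>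
  have "?f (2 ^ m - Suc v) = - ?f v" if v: "v < 2 ^ m" for v
  proof -
    have c: "digit_sum p A B (2 ^ m - Suc v) m = ?\<alpha> - digit_sum p A B v m"
      using digit_sum_complement[OF v, of p A B] by simp
    have "even (2 ^ m - Suc v) \<longleftrightarrow> odd v"
      using v assms(2) by (simp add: even_diff_nat)
    then have "(-1) ^ (2 ^ m - Suc v) = - ((-1) ^ v :: 'a)" by (auto simp: minus_one_power_iff)
    then show ?thesis
      unfolding c using gauss_trinomial_symmetric[of ?\<alpha> "digit_sum p A B v m" i]
        digits_less_power[OF assms(3)] digit_sum_le[of m m p A B v] by (simp add: mult.assoc)
  qed
  then have "(\<Sum>v<2^m. ?f v) = - (\<Sum>v<2^m. ?f v)"
    by (subst sum.nat_diff_reindex[symmetric]) (simp add: sum_negf)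
  then show ?thesis by simp
qed

lemma alternating_sum_zero:
  fixes q :: "'a::{idom,ring_char_0}"
  assumes prim: "primitive_root q (p ^ m)" and m: "1 \<le> m" "m \<le> n" and st: "n \<le> s" "s \<le> t"
    and AB: "A + B < p"
  shows "(\<Sum>r<2^n. (-1) ^ r * gauss_binomial q (digit_sum p A B r s) i
            * gauss_binomial q ((\<Sum>j<t. (A + B) * p ^ j) - i) (digit_sum p A B r s)) = 0"
proof -
  interpret primitive_root q "p ^ m" by fact
  define \<alpha> where "\<alpha> = (\<lambda>t. \<Sum>j<t. (A + B) * p ^ j)"
  define T where "T = (\<lambda>s t i r. (-1) ^ r * gauss_binomial q (digit_sum p A B r s) i
            * gauss_binomial q (\<alpha> t - i) (digit_sum p A B r s))"
  define h where "h = i div p ^ m"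
  define l where "l = i mod p ^ m"
  have i: "i = l + p ^ m * h" and l: "l < p ^ m" using pos by (simp_all add: h_def l_def)
  have \<alpha>_split: "\<alpha> t = \<alpha> m + p ^ m * \<alpha> (t - m)"
    unfolding \<alpha>_def using m st by (intro sum_split_low) simp
  have \<alpha>_less: "\<alpha> m < p ^ m" unfolding \<alpha>_def by (rule digits_less_power[OF AB])
  \<comment> \<open>The value 0 covers \<open>\<alpha> t < i\<close>, where natural subtraction
    truncates \<open>\<alpha> t - i\<close>; the summand vanishes there since its first factor has
    lower index \<open>i\<close> above the upper one.\<close>
  define C where "C = (\<lambda>u. if \<alpha> t < i then 0 else
      of_nat (digit_sum p A B u (s - m) choose h)
        * of_nat ((\<alpha> (t - m) - h) choose digit_sum p A B u (s - m)) :: 'a)"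
  have split: "T s t i (u * 2 ^ m + v) = C u * T m m l v" if v: "v < 2 ^ m" for u v
  proof -
    define k where "k = digit_sum p A B v m"
    define K where "K = digit_sum p A B u (s - m)"
    have D: "digit_sum p A B (u * 2 ^ m + v) s = k + p ^ m * K"
      unfolding k_def K_def using m st v by (intro digit_sum_split) auto
    have k: "k \<le> \<alpha> m" unfolding k_def \<alpha>_def by (rule digit_sum_le) simp
    have le: "k + p ^ m * K \<le> \<alpha> t" unfolding D[symmetric] \<alpha>_def by (rule digit_sum_le) fact
    have sgn: "(-1) ^ (u * 2 ^ m + v) = ((-1) ^ v :: 'a)" using m(1) by (simp add: minus_one_power_iff)
    have L: "gauss_binomial q (k + p ^ m * K) i = of_nat (K choose h) * gauss_binomial q k l"
      unfolding i using k \<alpha>_less l by (intro gauss_binomial_Lucas) auto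
    \<comment> \<open>If \<open>\<alpha> m < l\<close>, the low factor
      \<open>gauss_binomial q k l\<close> is 0 on both sides. In the third case
      \<open>\<alpha> t - i\<close> is computed without a borrow, so Lucas applies to the second
      factor as well.\<close>
    consider "\<alpha> t < i" | "\<alpha> m < l" | "i \<le> \<alpha> t" "l \<le> \<alpha> m" by linarith
    then show ?thesis
    proof cases
      case 1
      then show ?thesis using le by (simp add: T_def D C_def gauss_binomial_eq_0)
    next
      case 2
      then have "gauss_binomial q k l = 0" using k by (simp add: gauss_binomial_eq_0)
      then show ?thesis by (simp add: T_def D L flip: k_def)
    next
      case 3
      then have "h \<le> \<alpha> (t - m)"
      proof -
        have "p ^ m * h < p ^ m * Suc (\<alpha> (t - m))"
          using 3 \<alpha>_less i \<alpha>_split by (simp only: mult_Suc_right)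
        then show ?thesis by (simp only: mult_less_cancel1 less_Suc_eq_le)
      qed
      then obtain e where e: "\<alpha> (t - m) = h + e" using le_Suc_ex by blast
      have "\<alpha> t - i = (\<alpha> m - l) + p ^ m * (\<alpha> (t - m) - h)"
        unfolding \<alpha>_split i e using 3(2) by (simp add: distrib_left)
      then have M: "gauss_binomial q (\<alpha> t - i) (k + p ^ m * K)
          = of_nat ((\<alpha> (t - m) - h) choose K) * gauss_binomial q (\<alpha> m - l) k"
        using k \<alpha>_less by (simp add: gauss_binomial_Lucas)
      show ?thesis
        unfolding T_def D L M sgn C_def using 3 by (simp add: mult_ac flip: k_def K_def)
    qed
  qed
  \<comment> \<open>Grouping \<open>r\<close> into blocks of length \<open>2 ^ m\<close> isolates
    the low-digit sum, which is already known to vanish.\<close>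
  have "(\<Sum>r<2^n. T s t i r) = (\<Sum>r<2^(n-m) * 2^m. T s t i r)"
    using m by (simp flip: power_add)
  also have "\<dots> = (\<Sum>u<2^(n-m). \<Sum>v<2^m. T s t i (u * 2 ^ m + v))"
    unfolding sum.nat_group[of "T s t i", symmetric]
    by (simp only: sum.atLeastLessThan_shift_0[of "T s t i"] o_def add_diff_cancel_left' lessThan_atLeast0)
  also have "\<dots> = (\<Sum>u<2^(n-m). C u * (\<Sum>v<2^m. T m m l v))"
    by (simp add: split sum_distrib_left)
  also have "(\<Sum>v<2^m. T m m l v) = 0"
    unfolding T_def \<alpha>_def using alternating_sum_low_digits[OF prim m(1) AB] by simp
  finally show ?thesis by (simp add: T_def \<alpha>_def)
qed

text \<open>The least positive exponent \<open>d\<close> with \<open>z ^ d = 1\<close> divides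
  \<open>p ^ n\<close>, hence is a power of \<open>p\<close>; \<open>z \<noteq> 1\<close> excludes
  \<open>d = 1\<close>.\<close>

lemma primitive_root_of_prime_power:
  fixes z :: "'a::idom"
  assumes "prime p" "z ^ p ^ n = 1" "z \<noteq> 1"
  obtains m where "1 \<le> m" "m \<le> n" "primitive_root z (p ^ m)"
proof -
  define d where "d = (LEAST d. 0 < d \<and> z ^ d = 1)"
  have "0 < p ^ n \<and> z ^ p ^ n = 1" using assms prime_gt_0_nat by simp
  then have d: "0 < d" "z ^ d = 1" unfolding d_def by (rule LeastI2; blast)+
  have least: "z ^ j \<noteq> 1" if "0 < j" "j < d" for j
    using not_less_Least[of j "\<lambda>d. 0 < d \<and> z ^ d = 1"] that by (auto simp: d_def)
  have "z ^ (p ^ n mod d) = z ^ (d * (p ^ n div d) + p ^ n mod d)"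
    by (simp only: power_add power_mult d(2)) simp
  then have "z ^ (p ^ n mod d) = 1" using assms(2) by simp
  then have "d dvd p ^ n" using least[of "p ^ n mod d"] d(1) by (auto simp: dvd_eq_mod_eq_0)
  then obtain m where m: "m \<le> n" "d = p ^ m" using divides_primepow_nat[OF assms(1)] by blast
  moreover have "1 \<le> m" using m d assms(3) by (cases m) auto
  ultimately show ?thesis using that d least by (auto simp: primitive_root_def)
qed

theorem corollary2p5:
  fixes p n s t i :: nat and a b :: int
  assumes "prime p" and "p > 2"
    and "n \<ge> 1"
    and "even a" and "even b"
    and "0 \<le> a" and "a < b" and "b \<le> int p - 1"
    and "s \<ge> 1" and "t \<ge> 1"
    and "n \<le> s" and "s \<le> t"
  shows "cong_Zq
           (\<Sum>r=0..2 ^ n - 1. (- 1) ^ r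
              * qbinomial (k_trunc p a b r s div 2) i
              * qbinomial (alpha_trunc p a b t - int i) (nat (k_trunc p a b r s div 2)))
           0 (qint (p ^ n))"
proof -
  define A where "A = nat (a div 2)"
  define B where "B = nat (b div 2)"
  have a: "a = 2 * int A" and b: "b = 2 * int B" using assms by (auto simp: A_def B_def)
  \<comment> \<open>\<open>A + B\<close> is the average of \<open>a\<close> and \<open>b\<close>,
    hence below \<open>b\<close>.\<close>
  have AB: "A + B < p" using assms(6-8) a b by linarith
  define \<alpha> where "\<alpha> = (\<Sum>j<t. (A + B) * p ^ j)"
  define k where "k = (\<lambda>r. digit_sum p A B r s)"
  define S :: "int poly" where "S = (\<Sum>r<2^n. (-1) ^ r * gauss_binomial [:0, 1:] (k r) i
      * gauss_binomial [:0, 1:] (\<alpha> - i) (k r))"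
  have \<alpha>: "alpha_trunc p a b t = int \<alpha>"
    by (simp add: alpha_trunc_def \<alpha>_def a b)
  have k: "k_trunc p a b r s div 2 = int (k r)" for r
  proof -
    have "k_trunc p a b r s = 2 * int (k r)"
      unfolding k_trunc_def k_def digit_sum_def of_nat_sum sum_distrib_left
      by (intro sum.cong) (auto simp: a b bin_digit_def mod2_eq_if algebra_simps)
    then show ?thesis by simp
  qed
  \<comment> \<open>For \<open>i > \<alpha>\<close> the integer and the truncated difference
    disagree, but then \<open>k r \<le> \<alpha> < i\<close> makes the first factor 0 on both
    sides.\<close>
  have "qbinomial (int (k r)) i * qbinomial (int \<alpha> - int i) (k r)
      = gauss_binomial qvar (k r) i * gauss_binomial qvar (\<alpha> - i) (k r)" for r
  proof (cases "i \<le> \<alpha>")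
    case True
    then show ?thesis by (simp add: qbinomial_eq_gauss flip: of_nat_diff)
  next
    case False
    then have "k r < i" using digit_sum_le[OF assms(12), of p A B r] by (simp add: k_def \<alpha>_def)
    then show ?thesis by (simp add: qbinomial_eq_0 gauss_binomial_eq_0)
  qed
  moreover have "to_fract (gauss_binomial [:0, 1:] N l) = gauss_binomial qvar N l" for N l
    unfolding qvar_def by (rule gauss_binomial_hom) simp_all
  moreover have "to_fract ((-1) ^ r) = (-1 :: int poly fract) ^ r" for r
    by (induction r) simp_all
  moreover have "{0..2 ^ n - 1} = {..<2 ^ n :: nat}" by (simp add: atLeast0AtMost flip: lessThan_Suc_atMost)
  ultimately have "(\<Sum>r=0..2 ^ n - 1. (- 1) ^ r
              * qbinomial (k_trunc p a b r s div 2) i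
              * qbinomial (alpha_trunc p a b t - int i) (nat (k_trunc p a b r s div 2))) = to_fract S"
    by (simp add: S_def k \<alpha> mult.assoc)
  moreover have "cong_Zq (to_fract S) 0 (qint (p ^ n))"
  proof (rule cong_Zq_qintI)
    show "0 < p ^ n" using assms(2) by simp
  next
    fix z :: complex
    assume z: "z ^ p ^ n = 1" "z \<noteq> 1"
    obtain m where m: "1 \<le> m" "m \<le> n" "primitive_root z (p ^ m)"
      using primitive_root_of_prime_power[OF assms(1) z] .
    have "eval_complex (gauss_binomial [:0, 1:] N l) z = gauss_binomial (eval_complex [:0, 1:] z) N l" for N l
      by (rule gauss_binomial_hom) (simp_all add: map_poly_of_int_add map_poly_of_int_mult)
    then have "eval_complex S z = (\<Sum>r<2^n. (-1) ^ r * gauss_binomial z (k r) i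
      * gauss_binomial z (\<alpha> - i) (k r))"
      by (simp add: S_def eval_complex_sum map_poly_of_int_mult eval_complex_minus_one_power map_poly_pCons)
    also have "\<dots> = 0" unfolding k_def \<alpha>_def
      by (rule alternating_sum_zero[OF m(3,1,2) assms(11,12) AB])
    finally show "eval_complex S z = 0" .
  qed
  ultimately show ?thesis by simp
qed

end
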